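(* Let $k$ be an algebraically closed field and let $R=k[x_1,\ldots,x_n]$. Let $X\subseteq k^n$ carry the induced Zariski topology, and let $\nu:X\to\mathbb{N}_{>0}$ be bounded. Then the map $$\Theta:\operatorname{Spec}_{\Phi_{X,\nu}}(R)\longrightarrow\operatorname{Sob}(X),\qquad \Theta(P)=X\cap V_{\mathrm{aff}}(P),$$ is (well defined and) a homeomorphism.
   Context: For $a=(a_1,\ldots,a_n)\in k^n$, $\mathfrak{m}_a=(x_1-a_1,\ldots,x_n-a_n)\subseteq R$. For an ideal $I$ of $R$, $V_{\mathrm{aff}}(I)=\{a\in k^n: f(a)=0\text{ for every }f\in I\}$. For every subset $A\subseteq R$, $\Phi^{*}_{X,\nu}(A)=\bigcap_{a\in X}\bigl(A+\mathfrak{m}_a^{\nu(a)}\bigr)$, where the intersection is $R$ if $X=\varnothing$. The function $\nu$ is bounded if there is a positive integer $N$ with $\nu(a)\le N$ for every $a\in X$. The fixed-prime spectrum is $\operatorname{Spec}_{\Phi_{X,\nu}}(R)=\{P\in\operatorname{Spec}(R):\Phi^{*}_{X,\nu}(P)=P\}$, equipped with the topology whose closed sets are $\{P\in\operatorname{Spec}_{\Phi_{X,\nu}}(R): I\subseteq P\}$ for ideals $I$ of $R$. For a topological space $T$, $\operatorname{Sob}(T)$ is the set of nonempty irreducible closed subsets of $T$, with the topology generated by the sets $\widetilde U=\{C\in\operatorname{Sob}(T): C\cap U\neq\varnothing\}$ for $U\subseteq T$ open. *)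

theory Defs
  imports
    "HOL-Algebra.Ideal_Product"
    "HOL-Analysis.Abstract_Topology"
    "HOL-Computational_Algebra.Polynomial"
    "HOL-Library.Poly_Mapping"
begin

section \<open>The polynomial ring in n variables and affine n-space\<close>

text \<open>Monomials are finitely supported exponent functions, polynomials finitely supported
  functions from monomials to coefficients. The variables are indexed by the natural
  numbers below \<open>n\<close>, so \<open>n = 0\<close> is allowed.\<close>

definition mpoly_ring :: "nat \<Rightarrow> ((nat \<Rightarrow>\<^sub>0 nat) \<Rightarrow>\<^sub>0 'k::field) ring" where
  "mpoly_ring n = \<lparr>carrier = {f. \<forall>m \<in> Poly_Mapping.keys f. Poly_Mapping.keys m \<subseteq> {..<n}},
     monoid.mult = (*), one = 1, zero = 0, add = (+)\<rparr>"

definition mpoly_var :: "nat \<Rightarrow> ((nat \<Rightarrow>\<^sub>0 nat) \<Rightarrow>\<^sub>0 'k::field)" where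
  "mpoly_var i = Poly_Mapping.single (Poly_Mapping.single i 1) 1"

definition mpoly_const :: "'k \<Rightarrow> ((nat \<Rightarrow>\<^sub>0 nat) \<Rightarrow>\<^sub>0 'k::field)" where
  "mpoly_const c = Poly_Mapping.single 0 c"

definition monom_eval :: "(nat \<Rightarrow>\<^sub>0 nat) \<Rightarrow> (nat \<Rightarrow> 'k::field) \<Rightarrow> 'k" where
  "monom_eval m a = (\<Prod>i \<in> Poly_Mapping.keys m. a i ^ Poly_Mapping.lookup m i)"

definition mpoly_eval :: "((nat \<Rightarrow>\<^sub>0 nat) \<Rightarrow>\<^sub>0 'k::field) \<Rightarrow> (nat \<Rightarrow> 'k) \<Rightarrow> 'k" where
  "mpoly_eval f a =
     (\<Sum>m \<in> Poly_Mapping.keys f. Poly_Mapping.lookup f m * monom_eval m a)"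

text \<open>Points of affine space are extensional: they take the value \<open>undefined\<close> outside
  \<open>{..<n}\<close>, so that they correspond one-to-one to n-tuples.\<close>

definition affine_space :: "nat \<Rightarrow> (nat \<Rightarrow> 'k::field) set" where
  "affine_space n = {..<n} \<rightarrow>\<^sub>E UNIV"

definition V_aff :: "nat \<Rightarrow> ((nat \<Rightarrow>\<^sub>0 nat) \<Rightarrow>\<^sub>0 'k::field) set \<Rightarrow> (nat \<Rightarrow> 'k) set" where
  "V_aff n I = {a \<in> affine_space n. \<forall>f \<in> I. mpoly_eval f a = 0}"

definition point_ideal :: "nat \<Rightarrow> (nat \<Rightarrow> 'k::field) \<Rightarrow> ((nat \<Rightarrow>\<^sub>0 nat) \<Rightarrow>\<^sub>0 'k) set" where
  "point_ideal n a = Idl\<^bsub>mpoly_ring n\<^esub> ((\<lambda>i. mpoly_var i - mpoly_const (a i)) ` {..<n})"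

section \<open>The closure operation and its fixed primes\<close>

text \<open>Powers of ideals are taken in the multiplicative monoid of \<open>ideals_set\<close>, whose product
  is the product of ideals and whose unit is the unit ideal.\<close>

definition Phi_star ::
  "nat \<Rightarrow> (nat \<Rightarrow> 'k::field) set \<Rightarrow> ((nat \<Rightarrow> 'k) \<Rightarrow> nat) \<Rightarrow>
     ((nat \<Rightarrow>\<^sub>0 nat) \<Rightarrow>\<^sub>0 'k) set \<Rightarrow> ((nat \<Rightarrow>\<^sub>0 nat) \<Rightarrow>\<^sub>0 'k) set" where
  "Phi_star n X \<nu> A = carrier (mpoly_ring n) \<inter>
     (\<Inter>a\<in>X. A <+>\<^bsub>mpoly_ring n\<^esub>
       (point_ideal n a [^]\<^bsub>ideals_set (mpoly_ring n)\<^esub> \<nu> a))"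

definition Spec_Phi ::
  "nat \<Rightarrow> (nat \<Rightarrow> 'k::field) set \<Rightarrow> ((nat \<Rightarrow> 'k) \<Rightarrow> nat) \<Rightarrow>
     ((nat \<Rightarrow>\<^sub>0 nat) \<Rightarrow>\<^sub>0 'k) set set" where
  "Spec_Phi n X \<nu> = {P. primeideal P (mpoly_ring n) \<and> Phi_star n X \<nu> P = P}"

section \<open>The topologies\<close>

definition topology_of_closed_sets :: "'a set \<Rightarrow> 'a set set \<Rightarrow> 'a topology" where
  "topology_of_closed_sets S \<C> = topology (\<lambda>U. \<exists>C\<in>\<C>. U = S - C)"

definition zariski_topology :: "nat \<Rightarrow> (nat \<Rightarrow> 'k::field) topology" where
  "zariski_topology n =
     topology_of_closed_sets (affine_space n) {V_aff n I | I. ideal I (mpoly_ring n)}"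

definition Spec_Phi_topology ::
  "nat \<Rightarrow> (nat \<Rightarrow> 'k::field) set \<Rightarrow> ((nat \<Rightarrow> 'k) \<Rightarrow> nat) \<Rightarrow>
     ((nat \<Rightarrow>\<^sub>0 nat) \<Rightarrow>\<^sub>0 'k) set topology" where
  "Spec_Phi_topology n X \<nu> = topology_of_closed_sets (Spec_Phi n X \<nu>)
     {{P \<in> Spec_Phi n X \<nu>. I \<subseteq> P} | I. ideal I (mpoly_ring n)}"

definition irreducible_in :: "'a topology \<Rightarrow> 'a set \<Rightarrow> bool" where
  "irreducible_in T C \<longleftrightarrow> C \<subseteq> topspace T \<and> C \<noteq> {} \<and>
     (\<forall>A B. closedin (subtopology T C) A \<and> closedin (subtopology T C) B \<and> C = A \<union> B
        \<longrightarrow> A = C \<or> B = C)"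

definition Sob :: "'a topology \<Rightarrow> 'a set set" where
  "Sob T = {C. closedin T C \<and> irreducible_in T C}"

definition Sob_topology :: "'a topology \<Rightarrow> 'a set topology" where
  "Sob_topology T = topology_generated_by {{C \<in> Sob T. C \<inter> U \<noteq> {}} | U. openin T U}"

section \<open>The closed-set families above define topologies\<close>

lemma
  assumes sub: "\<And>C. C \<in> \<C> \<Longrightarrow> C \<subseteq> S"
    and empty: "{} \<in> \<C>"
    and un: "\<And>C D. C \<in> \<C> \<Longrightarrow> D \<in> \<C> \<Longrightarrow> C \<union> D \<in> \<C>"
    and inter: "\<And>\<K>. \<K> \<subseteq> \<C> \<Longrightarrow> S \<inter> \<Inter>\<K> \<in> \<C>"
  shows openin_topology_of_closed_sets:
      "openin (topology_of_closed_sets S \<C>) U \<longleftrightarrow> (\<exists>C\<in>\<C>. U = S - C)" (is ?op)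
    and topspace_topology_of_closed_sets: "topspace (topology_of_closed_sets S \<C>) = S" (is ?ts)
    and closedin_topology_of_closed_sets:
      "closedin (topology_of_closed_sets S \<C>) D \<longleftrightarrow> D \<in> \<C>" (is ?cl)
proof -
  have "istopology (\<lambda>U. \<exists>C\<in>\<C>. U = S - C)"
    unfolding istopology_def
  proof (intro conjI allI impI)
    fix U V assume "\<exists>C\<in>\<C>. U = S - C" "\<exists>C\<in>\<C>. V = S - C"
    then obtain C D where "C \<in> \<C>" "D \<in> \<C>" "U = S - C" "V = S - D" by blast
    then show "\<exists>C\<in>\<C>. U \<inter> V = S - C"
      by (intro bexI[of _ "C \<union> D"] un) auto
  next
    fix \<U> assume *: "\<forall>U\<in>\<U>. \<exists>C\<in>\<C>. U = S - C"
    let ?K = "{C \<in> \<C>. S - C \<in> \<U>}"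
    have "\<Union>\<U> = S - (S \<inter> \<Inter>?K)"
    proof
      show "\<Union>\<U> \<subseteq> S - (S \<inter> \<Inter>?K)"
      proof
        fix x assume "x \<in> \<Union>\<U>"
        then obtain U where U: "U \<in> \<U>" "x \<in> U" by blast
        then obtain C where C: "C \<in> \<C>" "U = S - C" using * by blast
        then have "C \<in> ?K" using U by blast
        then show "x \<in> S - (S \<inter> \<Inter>?K)" using U(2) C(2) by blast
      qed
      show "S - (S \<inter> \<Inter>?K) \<subseteq> \<Union>\<U>" by blast
    qed
    moreover have "S \<inter> \<Inter>?K \<in> \<C>" by (rule inter) auto
    ultimately show "\<exists>C\<in>\<C>. \<Union>\<U> = S - C" by blast
  qed
  then have op: "\<And>U. openin (topology_of_closed_sets S \<C>) U \<longleftrightarrow> (\<exists>C\<in>\<C>. U = S - C)"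
    by (simp add: topology_of_closed_sets_def)
  then show ?op .
  have "openin (topology_of_closed_sets S \<C>) S"
    using op empty by blast
  moreover have "openin (topology_of_closed_sets S \<C>) U \<Longrightarrow> U \<subseteq> S" for U
    using op by auto
  ultimately show ts: ?ts
    unfolding topspace_def by auto
  show ?cl
    unfolding closedin_def ts op
  proof
    assume "D \<subseteq> S \<and> (\<exists>C\<in>\<C>. S - D = S - C)"
    then obtain C where "D \<subseteq> S" "C \<in> \<C>" "S - D = S - C" by blast
    moreover from this have "D = C" using sub[of C] by blast
    ultimately show "D \<in> \<C>" by simp
  next
    assume "D \<in> \<C>"
    then show "D \<subseteq> S \<and> (\<exists>C\<in>\<C>. S - D = S - C)" using sub by blast
  qed
qed

lemma mpoly_ring_simps [simp]:
  "f \<in> carrier (mpoly_ring n) \<longleftrightarrow> (\<forall>m\<in>Poly_Mapping.keys f. Poly_Mapping.keys m \<subseteq> {..<n})"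
  "f \<otimes>\<^bsub>mpoly_ring n\<^esub> g = f * g"
  "f \<oplus>\<^bsub>mpoly_ring n\<^esub> g = f + g"
  "\<one>\<^bsub>mpoly_ring n\<^esub> = 1"
  "\<zero>\<^bsub>mpoly_ring n\<^esub> = 0"
  by (simp_all add: mpoly_ring_def)

lemma cring_mpoly_ring:
  "cring (mpoly_ring n :: ((nat \<Rightarrow>\<^sub>0 nat) \<Rightarrow>\<^sub>0 'k::field) ring)" (is "cring ?R")
proof (rule cringI)
  show "abelian_group ?R"
  proof (rule abelian_groupI; (simp add: algebra_simps; fail)?)
    fix f g :: "(nat \<Rightarrow>\<^sub>0 nat) \<Rightarrow>\<^sub>0 'k"
    assume "f \<in> carrier ?R" "g \<in> carrier ?R"
    then show "f \<oplus>\<^bsub>?R\<^esub> g \<in> carrier ?R"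
      using Poly_Mapping.keys_add[of f g] by auto
  next
    fix f :: "(nat \<Rightarrow>\<^sub>0 nat) \<Rightarrow>\<^sub>0 'k"
    assume "f \<in> carrier ?R"
    then show "\<exists>g\<in>carrier ?R. g \<oplus>\<^bsub>?R\<^esub> f = \<zero>\<^bsub>?R\<^esub>"
      by (intro bexI[of _ "- f"]) (auto simp: in_keys_iff)
  qed
  show "comm_monoid ?R"
  proof (rule comm_monoidI; (simp add: algebra_simps; fail)?)
    fix f g :: "(nat \<Rightarrow>\<^sub>0 nat) \<Rightarrow>\<^sub>0 'k"
    assume fg: "f \<in> carrier ?R" "g \<in> carrier ?R"
    have "Poly_Mapping.keys m \<subseteq> {..<n}" if m: "m \<in> Poly_Mapping.keys (f * g)" for m
    proof -
      obtain a b where "a \<in> Poly_Mapping.keys f" "b \<in> Poly_Mapping.keys g" "m = a + b"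
        using keys_mult[of f g] m by blast
      then show ?thesis
        using fg Poly_Mapping.keys_add[of a b] by (simp, blast)
    qed
    then show "f \<otimes>\<^bsub>?R\<^esub> g \<in> carrier ?R" by auto
  qed
qed (simp add: algebra_simps)

lemma monom_eval_superset:
  assumes "finite I" "Poly_Mapping.keys m \<subseteq> I"
  shows "monom_eval m a = (\<Prod>i\<in>I. a i ^ Poly_Mapping.lookup m i)"
  unfolding monom_eval_def using assms
  by (intro prod.mono_neutral_left) (auto simp: in_keys_iff)

lemma monom_eval_add: "monom_eval (m + m') a = monom_eval m a * monom_eval m' a"
proof -
  let ?I = "Poly_Mapping.keys m \<union> Poly_Mapping.keys m'"
  have "monom_eval (m + m') a = (\<Prod>i\<in>?I. a i ^ Poly_Mapping.lookup (m + m') i)"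
    using Poly_Mapping.keys_add[of m m'] by (intro monom_eval_superset) auto
  also have "\<dots> = monom_eval m a * monom_eval m' a"
    by (simp add: lookup_add power_add prod.distrib monom_eval_superset[of ?I])
  finally show ?thesis .
qed

lemma mpoly_eval_add: "mpoly_eval (f + g) a = mpoly_eval f a + mpoly_eval g a"
  unfolding mpoly_eval_def
  by (rule setsum_keys_plus_distrib) (simp_all add: distrib_right)

lemma mpoly_eval_single: "mpoly_eval (Poly_Mapping.single m c) a = c * monom_eval m a"
  by (simp add: mpoly_eval_def)

lemma mpoly_eval_zero: "mpoly_eval 0 a = 0"
  by (simp add: mpoly_eval_def)

lemma mpoly_eval_one: "mpoly_eval 1 a = 1"
  by (simp add: mpoly_eval_def monom_eval_def)

lemma mpoly_induct [case_names zero single sum]: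
  fixes f :: "'a \<Rightarrow>\<^sub>0 'b::comm_monoid_add"
  assumes "Q 0" "\<And>m c. Q (Poly_Mapping.single m c)" "\<And>f g. Q f \<Longrightarrow> Q g \<Longrightarrow> Q (f + g)"
  shows "Q f"
proof (induction f rule: update_induct)
  case const
  then show ?case by (simp add: assms(1))
next
  case (update f m c)
  have "Poly_Mapping.update m c f = f + Poly_Mapping.single m c"
    using update(1) by (intro poly_mapping_eqI)
      (auto simp: lookup_update lookup_add lookup_single in_keys_iff)
  then show ?case using update assms by simp
qed

lemma mpoly_eval_mult: "mpoly_eval (f * g) a = mpoly_eval f a * mpoly_eval g a"
proof -
  have single: "mpoly_eval (Poly_Mapping.single m c * g) a = c * monom_eval m a * mpoly_eval g a"
    for m c
    by (induction g rule: mpoly_induct)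
      (simp_all add: mult_single mpoly_eval_zero mpoly_eval_single mpoly_eval_add monom_eval_add distrib_left)
  show ?thesis
    by (induction f rule: mpoly_induct)
      (simp_all add: single mpoly_eval_zero mpoly_eval_single mpoly_eval_add distrib_right)
qed

lemma ideal_mpoly_mult:
  assumes "ideal I (mpoly_ring n)" "ideal J (mpoly_ring n)" "f \<in> I" "g \<in> J"
  shows "f * g \<in> I \<inter> J"
  using ideal.I_r_closed[OF assms(1,3), of g] ideal.I_l_closed[OF assms(2,4), of f]
    ideal.Icarr[OF assms(1,3)] ideal.Icarr[OF assms(2,4)] by simp

lemma ideal_sum_family:
  assumes "\<And>I. I \<in> \<I> \<Longrightarrow> ideal I (mpoly_ring n)"
  obtains J where "ideal J (mpoly_ring n)" "\<Union>\<I> \<subseteq> J"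
    "\<And>K. ideal K (mpoly_ring n) \<Longrightarrow> \<Union>\<I> \<subseteq> K \<Longrightarrow> J \<subseteq> K"
proof -
  interpret cring "mpoly_ring n" by (rule cring_mpoly_ring)
  have "\<Union>\<I> \<subseteq> carrier (mpoly_ring n)"
  proof
    fix f assume "f \<in> \<Union>\<I>"
    then obtain I where I: "I \<in> \<I>" "f \<in> I" by blast
    show "f \<in> carrier (mpoly_ring n)" by (rule ideal.Icarr[OF assms[OF I(1)] I(2)])
  qed
  then show ?thesis
    by (intro that[of "Idl\<^bsub>mpoly_ring n\<^esub> (\<Union>\<I>)"] genideal_ideal genideal_self genideal_minimal)
qed

lemma ideal_vanishing:
  "ideal {f \<in> carrier (mpoly_ring n). \<forall>a\<in>X. mpoly_eval f a = 0} (mpoly_ring n)"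
    (is "ideal ?I _")
proof -
  interpret R: cring "mpoly_ring n" by (rule cring_mpoly_ring)
  have inv: "mpoly_eval (\<ominus>\<^bsub>mpoly_ring n\<^esub> f) a = - mpoly_eval f a"
    if "f \<in> carrier (mpoly_ring n)" for f and a :: "nat \<Rightarrow> 'a"
    using R.l_neg[OF that] mpoly_eval_add[of "\<ominus>\<^bsub>mpoly_ring n\<^esub> f" f a]
    by (simp add: mpoly_eval_zero eq_neg_iff_add_eq_0)
  show ?thesis
  proof (rule idealI)
    show "ring (mpoly_ring n)" by (rule R.ring_axioms)
    show "subgroup ?I (add_monoid (mpoly_ring n))"
    proof (rule R.add.subgroupI)
      have "\<zero>\<^bsub>mpoly_ring n\<^esub> \<in> ?I" by (simp add: mpoly_eval_zero)
      then show "?I \<noteq> {}" by blast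
    next
      fix f assume "f \<in> ?I"
      then show "\<ominus>\<^bsub>mpoly_ring n\<^esub> f \<in> ?I"
        using inv[of f] R.a_inv_closed[of f] by (simp del: mpoly_ring_simps)
    next
      fix f g assume "f \<in> ?I" "g \<in> ?I"
      then show "f \<oplus>\<^bsub>mpoly_ring n\<^esub> g \<in> ?I"
        using R.a_closed[of f g] by (simp add: mpoly_eval_add del: mpoly_ring_simps(1))
    qed blast
    show "g \<otimes>\<^bsub>mpoly_ring n\<^esub> f \<in> ?I" if "f \<in> ?I" "g \<in> carrier (mpoly_ring n)" for f g
      using that R.m_closed[of g f] by (simp add: mpoly_eval_mult del: mpoly_ring_simps(1))
    show "f \<otimes>\<^bsub>mpoly_ring n\<^esub> g \<in> ?I" if "f \<in> ?I" "g \<in> carrier (mpoly_ring n)" for f g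
      using that R.m_closed[of f g] by (simp add: mpoly_eval_mult del: mpoly_ring_simps(1))
  qed
qed

lemma
  shows topspace_zariski_topology: "topspace (zariski_topology n) = affine_space n"
    and closedin_zariski_topology:
      "closedin (zariski_topology n) C \<longleftrightarrow> (\<exists>I. ideal I (mpoly_ring n) \<and> C = V_aff n I)"
proof -
  interpret R: cring "mpoly_ring n" by (rule cring_mpoly_ring)
  let ?C = "{V_aff n I | I. ideal I (mpoly_ring n)}"
  have 1: "C \<subseteq> affine_space n" if "C \<in> ?C" for C
    using that by (auto simp: V_aff_def)
  have 2: "{} \<in> ?C"
  proof -
    have "V_aff n (carrier (mpoly_ring n)) = {}"
      using R.one_closed by (auto simp: V_aff_def mpoly_eval_one simp del: mpoly_ring_simps(1)
        intro!: bexI[of _ 1])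
    then show ?thesis using R.oneideal by blast
  qed
  have 3: "C \<union> D \<in> ?C" if CD: "C \<in> ?C" "D \<in> ?C" for C D
  proof -
    obtain I J where I: "ideal I (mpoly_ring n)" "C = V_aff n I"
      and J: "ideal J (mpoly_ring n)" "D = V_aff n J" using CD by blast
    have "a \<in> V_aff n I \<union> V_aff n J" if a: "a \<in> V_aff n (I \<inter> J)" for a
    proof (rule ccontr)
      assume "\<not> ?thesis"
      then obtain f g where "f \<in> I" "g \<in> J" "mpoly_eval f a \<noteq> 0" "mpoly_eval g a \<noteq> 0"
        using a by (auto simp: V_aff_def)
      then show False
        using ideal_mpoly_mult[OF I(1) J(1), of f g] a mpoly_eval_mult[of f g a]
        unfolding V_aff_def by (metis (mono_tags, lifting) mem_Collect_eq mult_eq_0_iff)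
    qed
    then have "C \<union> D = V_aff n (I \<inter> J)" unfolding I J by (auto simp: V_aff_def)
    then show ?thesis using R.i_intersect[OF I(1) J(1)] by blast
  qed
  have 4: "affine_space n \<inter> \<Inter>\<K> \<in> ?C" if "\<K> \<subseteq> ?C" for \<K>
  proof -
    let ?I = "{I. ideal I (mpoly_ring n) \<and> V_aff n I \<in> \<K>}"
    obtain J where J: "ideal J (mpoly_ring n)" "\<Union>?I \<subseteq> J"
      "\<And>K. ideal K (mpoly_ring n) \<Longrightarrow> \<Union>?I \<subseteq> K \<Longrightarrow> J \<subseteq> K"
      using ideal_sum_family[of ?I n] by blast
    have "affine_space n \<inter> \<Inter>\<K> = V_aff n J"
    proof
      show "V_aff n J \<subseteq> affine_space n \<inter> \<Inter>\<K>"
        using J(2) \<open>\<K> \<subseteq> ?C\<close> unfolding V_aff_def by blast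
      show "affine_space n \<inter> \<Inter>\<K> \<subseteq> V_aff n J"
      proof
        fix a assume a: "a \<in> affine_space n \<inter> \<Inter>\<K>"
        have "\<Union>?I \<subseteq> {f \<in> carrier (mpoly_ring n). \<forall>b\<in>{a}. mpoly_eval f b = 0}"
        proof
          fix f assume "f \<in> \<Union>?I"
          then obtain I where I: "ideal I (mpoly_ring n)" "V_aff n I \<in> \<K>" "f \<in> I" by blast
          have "a \<in> V_aff n I" using a I(2) by blast
          then show "f \<in> {f \<in> carrier (mpoly_ring n). \<forall>b\<in>{a}. mpoly_eval f b = 0}"
            using I(3) ideal.Icarr[OF I(1,3)] unfolding V_aff_def by blast
        qed
        then have "J \<subseteq> {f \<in> carrier (mpoly_ring n). \<forall>b\<in>{a}. mpoly_eval f b = 0}"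
          by (rule J(3)[OF ideal_vanishing])
        then show "a \<in> V_aff n J" using a by (auto simp: V_aff_def)
      qed
    qed
    then show ?thesis using J(1) by blast
  qed
  show "topspace (zariski_topology n) = affine_space n"
    unfolding zariski_topology_def by (rule topspace_topology_of_closed_sets[OF 1 2 3 4])
  show "closedin (zariski_topology n) C \<longleftrightarrow> (\<exists>I. ideal I (mpoly_ring n) \<and> C = V_aff n I)"
    unfolding zariski_topology_def using closedin_topology_of_closed_sets[OF 1 2 3 4] by auto
qed

lemma
  shows topspace_Spec_Phi_topology: "topspace (Spec_Phi_topology n X \<nu>) = Spec_Phi n X \<nu>"
    and closedin_Spec_Phi_topology:
      "closedin (Spec_Phi_topology n X \<nu>) C \<longleftrightarrow>
         (\<exists>I. ideal I (mpoly_ring n) \<and> C = {P \<in> Spec_Phi n X \<nu>. I \<subseteq> P})"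
proof -
  interpret R: cring "mpoly_ring n" by (rule cring_mpoly_ring)
  let ?S = "Spec_Phi n X \<nu>"
  let ?C = "{{P \<in> ?S. I \<subseteq> P} | I. ideal I (mpoly_ring n)}"
  have prime: "primeideal P (mpoly_ring n)" "ideal P (mpoly_ring n)" if "P \<in> ?S" for P
    using that by (auto simp: Spec_Phi_def primeideal.axioms)
  have 1: "C \<subseteq> ?S" if "C \<in> ?C" for C
    using that by auto
  have 2: "{} \<in> ?C"
  proof -
    have "\<not> carrier (mpoly_ring n) \<subseteq> P" if "P \<in> ?S" for P
      using primeideal.I_notcarr[OF prime(1)[OF that]] ideal.Icarr[OF prime(2)[OF that]] by blast
    then have "{P \<in> ?S. carrier (mpoly_ring n) \<subseteq> P} = {}" by blast
    then show ?thesis using R.oneideal by blast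
  qed
  have 3: "C \<union> D \<in> ?C" if CD: "C \<in> ?C" "D \<in> ?C" for C D
  proof -
    obtain I J where I: "ideal I (mpoly_ring n)" "C = {P \<in> ?S. I \<subseteq> P}"
      and J: "ideal J (mpoly_ring n)" "D = {P \<in> ?S. J \<subseteq> P}" using CD by blast
    have "I \<subseteq> P \<or> J \<subseteq> P" if P: "P \<in> ?S" "I \<inter> J \<subseteq> P" for P
    proof (rule ccontr)
      assume "\<not> ?thesis"
      then obtain f g where fg: "f \<in> I" "g \<in> J" "f \<notin> P" "g \<notin> P" by blast
      have "f \<otimes>\<^bsub>mpoly_ring n\<^esub> g \<in> P"
        using ideal_mpoly_mult[OF I(1) J(1) fg(1,2)] P(2) by auto
      then show False
        using primeideal.I_prime[OF prime(1)[OF P(1)] ideal.Icarr[OF I(1) fg(1)]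
            ideal.Icarr[OF J(1) fg(2)]] fg(3,4) by blast
    qed
    then have "C \<union> D = {P \<in> ?S. I \<inter> J \<subseteq> P}" unfolding I J by blast
    then show ?thesis using R.i_intersect[OF I(1) J(1)] by blast
  qed
  have 4: "?S \<inter> \<Inter>\<K> \<in> ?C" if "\<K> \<subseteq> ?C" for \<K>
  proof -
    let ?I = "{I. ideal I (mpoly_ring n) \<and> {P \<in> ?S. I \<subseteq> P} \<in> \<K>}"
    obtain J where J: "ideal J (mpoly_ring n)" "\<Union>?I \<subseteq> J"
      "\<And>K. ideal K (mpoly_ring n) \<Longrightarrow> \<Union>?I \<subseteq> K \<Longrightarrow> J \<subseteq> K"
      using ideal_sum_family[of ?I n] by blast
    have "P \<in> \<Inter>\<K> \<longleftrightarrow> J \<subseteq> P" if "P \<in> ?S" for P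
    proof
      assume "P \<in> \<Inter>\<K>"
      then have "\<Union>?I \<subseteq> P" by blast
      then show "J \<subseteq> P" by (rule J(3)[OF prime(2)[OF that]])
    next
      assume "J \<subseteq> P"
      then show "P \<in> \<Inter>\<K>" using J(2) that \<open>\<K> \<subseteq> ?C\<close> by blast
    qed
    then have "?S \<inter> \<Inter>\<K> = {P \<in> ?S. J \<subseteq> P}" by blast
    then show ?thesis using J(1) by blast
  qed
  show "topspace (Spec_Phi_topology n X \<nu>) = ?S"
    unfolding Spec_Phi_topology_def by (rule topspace_topology_of_closed_sets[OF 1 2 3 4])
  show "closedin (Spec_Phi_topology n X \<nu>) C \<longleftrightarrow>
         (\<exists>I. ideal I (mpoly_ring n) \<and> C = {P \<in> ?S. I \<subseteq> P})"
    unfolding Spec_Phi_topology_def using closedin_topology_of_closed_sets[OF 1 2 3 4] by auto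
qed

end

theory Submission
  imports Defs
begin

text \<open>
  For \<open>Y \<subseteq> k\<^sup>n\<close> write \<open>I(Y)\<close> for the ideal of polynomials vanishing on \<open>Y\<close>. The theorem is the
  classical dictionary between irreducible closed sets and their prime vanishing ideals, once
  the fixed primes are recognised as follows: a prime \<open>P\<close> satisfies \<open>\<Phi>\<^sup>*(P) = P\<close> if and only
  if \<open>I(X \<inter> V(P)) = P\<close> (lemma \<open>Spec_Phi_eq\<close>).

  If \<open>I(X \<inter> V(P)) = P\<close>, then at every point \<open>a \<in> X \<inter> V(P)\<close> the ideal
  \<open>P + \<mm>\<^sub>a\<^bsup>\<nu>(a)\<^esup>\<close> is contained in \<open>\<mm>\<^sub>a = I({a})\<close>, because \<open>\<nu>(a) > 0\<close>; intersecting over these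
  points gives \<open>\<Phi>\<^sup>*(P) \<subseteq> I(X \<inter> V(P)) = P\<close>.

  Conversely let \<open>f \<in> I(X \<inter> V(P))\<close>. For each \<open>a \<in> X\<close> some \<open>p \<in> P\<close> agrees with \<open>f\<close> at \<open>a\<close>:
  take \<open>p = 0\<close> when \<open>a \<in> V(P)\<close>, and a multiple of an element of \<open>P\<close> not vanishing at \<open>a\<close>
  otherwise. Hence \<open>f - p \<in> \<mm>\<^sub>a\<close>, and for a bound \<open>N\<close> of \<open>\<nu>\<close> the power
  \<open>f\<^sup>N\<close>, being congruent to \<open>(f - p)\<^sup>N\<close> modulo \<open>P\<close>, lies in \<open>P + \<mm>\<^sub>a\<^bsup>\<nu>(a)\<^esup>\<close>. The exponent \<open>N\<close> is the
  same for all \<open>a\<close>, so \<open>f\<^sup>N \<in> \<Phi>\<^sup>*(P)\<close>. If \<open>P\<close> is fixed, this gives \<open>f\<^sup>N \<in> P\<close> and then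
  \<open>f \<in> P\<close>, as \<open>P\<close> is prime.

  On the other side, the closed subsets of \<open>X\<close> are the sets \<open>C\<close> with \<open>X \<inter> V(I(C)) = C\<close>, and
  such a set is irreducible if and only if \<open>I(C)\<close> is prime. So \<open>P \<mapsto> X \<inter> V(P)\<close> and
  \<open>C \<mapsto> I(C)\<close> are mutually inverse bijections between the fixed primes and \<open>Sob(X)\<close>. They match
  the two topologies, since \<open>X \<inter> V(P)\<close> meets the complement of \<open>V(J)\<close> exactly when
  \<open>J\<close> is not contained in \<open>I(X \<inter> V(P)) = P\<close>.
\<close>

section \<open>Ideals of the polynomial ring and their powers\<close>

text \<open>Membership in the ring is handled below through closure properties; rewriting it to a
  condition on exponents would take these out of reach.\<close>

declare mpoly_ring_simps(1) [simp del]

lemma mpoly_ring_uminus: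
  fixes f :: "(nat \<Rightarrow>\<^sub>0 nat) \<Rightarrow>\<^sub>0 'k::field"
  assumes "f \<in> carrier (mpoly_ring n)"
  shows "\<ominus>\<^bsub>mpoly_ring n\<^esub> f = - f"
proof -
  interpret R: cring "mpoly_ring n :: ((nat \<Rightarrow>\<^sub>0 nat) \<Rightarrow>\<^sub>0 'k) ring" by (rule cring_mpoly_ring)
  show ?thesis using R.l_neg[OF assms] by (simp add: eq_neg_iff_add_eq_0)
qed

lemma mpoly_ring_pow:
  fixes f :: "(nat \<Rightarrow>\<^sub>0 nat) \<Rightarrow>\<^sub>0 'k::field"
  shows "f [^]\<^bsub>mpoly_ring n\<^esub> (i::nat) = f ^ i"
proof -
  interpret R: cring "mpoly_ring n :: ((nat \<Rightarrow>\<^sub>0 nat) \<Rightarrow>\<^sub>0 'k) ring" by (rule cring_mpoly_ring)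
  show ?thesis by (induction i) (simp_all add: mult.commute)
qed

lemma
  fixes f g :: "(nat \<Rightarrow>\<^sub>0 nat) \<Rightarrow>\<^sub>0 'k::field"
  assumes "f \<in> carrier (mpoly_ring n)"
  shows mpoly_ring_diff_closed: "g \<in> carrier (mpoly_ring n) \<Longrightarrow> f - g \<in> carrier (mpoly_ring n)"
    and mpoly_ring_mult_closed: "g \<in> carrier (mpoly_ring n) \<Longrightarrow> f * g \<in> carrier (mpoly_ring n)"
    and mpoly_ring_power_closed: "f ^ i \<in> carrier (mpoly_ring n)"
proof -
  interpret R: cring "mpoly_ring n :: ((nat \<Rightarrow>\<^sub>0 nat) \<Rightarrow>\<^sub>0 'k) ring" by (rule cring_mpoly_ring)
  show "g \<in> carrier (mpoly_ring n) \<Longrightarrow> f - g \<in> carrier (mpoly_ring n)"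
    using R.minus_closed[OF assms, of g] by (simp add: a_minus_def mpoly_ring_uminus)
  show "g \<in> carrier (mpoly_ring n) \<Longrightarrow> f * g \<in> carrier (mpoly_ring n)"
    using R.m_closed[OF assms, of g] by simp
  show "f ^ i \<in> carrier (mpoly_ring n)"
    using R.nat_pow_closed[OF assms, of i] by (simp add: mpoly_ring_pow)
qed

lemma
  fixes I :: "((nat \<Rightarrow>\<^sub>0 nat) \<Rightarrow>\<^sub>0 'k::field) set"
  assumes "ideal I (mpoly_ring n)"
  shows mpoly_ideal_zero: "0 \<in> I"
    and mpoly_ideal_add: "f \<in> I \<Longrightarrow> g \<in> I \<Longrightarrow> f + g \<in> I"
    and mpoly_ideal_mult: "f \<in> carrier (mpoly_ring n) \<Longrightarrow> g \<in> I \<Longrightarrow> f * g \<in> I"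
proof -
  interpret ideal I "mpoly_ring n" by (rule assms)
  show "0 \<in> I" using additive_subgroup.zero_closed[OF additive_subgroup_axioms] by simp
  show "f \<in> I \<Longrightarrow> g \<in> I \<Longrightarrow> f + g \<in> I"
    using additive_subgroup.a_closed[OF additive_subgroup_axioms, of f g] by simp
  show "f \<in> carrier (mpoly_ring n) \<Longrightarrow> g \<in> I \<Longrightarrow> f * g \<in> I" using I_l_closed[of g f] by simp
qed

lemma (in cring) ideal_power_is_ideal:
  assumes "ideal I R"
  shows "ideal (I [^]\<^bsub>ideals_set R\<^esub> (i::nat)) R"
proof -
  interpret S: comm_monoid "ideals_set R" by (rule ideals_set_is_comm_monoid)
  show ?thesis using S.nat_pow_closed[of I i] assms by (simp add: ideals_set_def)
qed

lemma (in cring) ideal_power_Suc: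
  assumes "ideal I R"
  shows "I [^]\<^bsub>ideals_set R\<^esub> Suc i = (I [^]\<^bsub>ideals_set R\<^esub> i) \<cdot> I"
proof -
  interpret S: comm_monoid "ideals_set R" by (rule ideals_set_is_comm_monoid)
  show ?thesis by (simp add: ideals_set_def)
qed

lemma (in cring) ideal_power_subset:
  assumes "ideal I R" "0 < (i::nat)"
  shows "I [^]\<^bsub>ideals_set R\<^esub> i \<subseteq> I"
  using assms ideal_power_Suc[of I] ideal_prod_inter[OF ideal_power_is_ideal[OF assms(1)] assms(1)]
  by (cases i) auto

lemma (in cring) pow_mem_ideal_power:
  assumes "ideal I R" "x \<in> I" "i \<le> (j::nat)"
  shows "x [^] j \<in> I [^]\<^bsub>ideals_set R\<^esub> i"
  using assms(3)
proof (induction j rule: nat_induct_at_least)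
  case base
  show ?case
  proof (induction i)
    case 0
    interpret S: comm_monoid "ideals_set R" by (rule ideals_set_is_comm_monoid)
    show ?case by (simp add: ideals_set_def)
  next
    case (Suc i)
    then show ?case
      unfolding ideal_power_Suc[OF assms(1)] using ideal_prod.prod[OF Suc assms(2), of R] by simp
  qed
next
  case (Suc j)
  then show ?case
    using ideal.I_r_closed[OF ideal_power_is_ideal[OF assms(1)]] ideal.Icarr[OF assms(1,2)] by simp
qed

section \<open>Vanishing ideals\<close>

definition vanishing_ideal ::
  "nat \<Rightarrow> (nat \<Rightarrow> 'k::field) set \<Rightarrow> ((nat \<Rightarrow>\<^sub>0 nat) \<Rightarrow>\<^sub>0 'k) set" where
  "vanishing_ideal n Y = {f \<in> carrier (mpoly_ring n). \<forall>a\<in>Y. mpoly_eval f a = 0}"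

lemma ideal_vanishing_ideal: "ideal (vanishing_ideal n Y) (mpoly_ring n)"
  unfolding vanishing_ideal_def by (rule ideal_vanishing)

lemma mpoly_eval_diff: "mpoly_eval (f - g) a = mpoly_eval f a - mpoly_eval g a"
  using mpoly_eval_add[of "f - g" g a] by simp

lemma mpoly_eval_const: "mpoly_eval (mpoly_const c) a = c"
  by (simp add: mpoly_const_def mpoly_eval_single monom_eval_def)

lemma mpoly_const_closed: "mpoly_const c \<in> carrier (mpoly_ring n)"
  by (simp add: mpoly_const_def mpoly_ring_simps(1))

lemma mpoly_eval_var: "mpoly_eval (mpoly_var i) a = a i"
  by (simp add: mpoly_var_def mpoly_eval_single monom_eval_def)

lemma mpoly_var_closed: "i < n \<Longrightarrow> mpoly_var i \<in> carrier (mpoly_ring n)"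
  by (simp add: mpoly_var_def mpoly_ring_simps(1))

lemma mpoly_var_power: "mpoly_var i ^ e = Poly_Mapping.single (Poly_Mapping.single i e) 1"
proof (induction e)
  case (Suc e)
  then show ?case
    unfolding power_Suc Suc by (simp add: mpoly_var_def mult_single flip: single_add)
qed simp

text \<open>A polynomial is built by adding one term at a time and a monomial by adding one variable at
  a time, so a property holds on the whole ring as soon as it survives sums and products of
  elements of the ring.\<close>

lemma mpoly_ring_induct [consumes 1, case_names const var add mult]:
  fixes f :: "(nat \<Rightarrow>\<^sub>0 nat) \<Rightarrow>\<^sub>0 'k::field"
  assumes f: "f \<in> carrier (mpoly_ring n)"
    and const: "\<And>c. Q (mpoly_const c)"
    and var: "\<And>i. i < n \<Longrightarrow> Q (mpoly_var i)"
    and add: "\<And>f g. f \<in> carrier (mpoly_ring n) \<Longrightarrow> g \<in> carrier (mpoly_ring n) \<Longrightarrow>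
      Q f \<Longrightarrow> Q g \<Longrightarrow> Q (f + g)"
    and mult: "\<And>f g. f \<in> carrier (mpoly_ring n) \<Longrightarrow> g \<in> carrier (mpoly_ring n) \<Longrightarrow>
      Q f \<Longrightarrow> Q g \<Longrightarrow> Q (f * g)"
  shows "Q f"
proof -
  have const_1: "mpoly_const 1 = (1 :: (nat \<Rightarrow>\<^sub>0 nat) \<Rightarrow>\<^sub>0 'k)"
    by (simp add: mpoly_const_def)
  have power: "Q (mpoly_var i ^ e)" if "i < n" for i e
    by (induction e)
      (use that const[of 1] in \<open>auto simp: const_1 intro: mult var mpoly_var_closed mpoly_ring_power_closed\<close>)
  have monom: "Q (Poly_Mapping.single m 1)" if "Poly_Mapping.keys m \<subseteq> {..<n}" for m
    using that
  proof (induction m rule: update_induct)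
    case const
    then show ?case using assms(2)[of 1] by (simp add: const_1)
  next
    case (update m i e)
    have keys: "i < n" "Poly_Mapping.keys m \<subseteq> {..<n}"
      using update by (auto simp: keys_update)
    have "Poly_Mapping.update i e m = m + Poly_Mapping.single i e"
      using update(1) by (intro poly_mapping_eqI)
        (auto simp: lookup_update lookup_add lookup_single in_keys_iff)
    then have "Poly_Mapping.single (Poly_Mapping.update i e m) 1
        = Poly_Mapping.single m 1 * (mpoly_var i ^ e :: (nat \<Rightarrow>\<^sub>0 nat) \<Rightarrow>\<^sub>0 'k)"
      by (simp add: mpoly_var_power mult_single)
    moreover have "Poly_Mapping.single m 1 \<in> carrier (mpoly_ring n :: ((nat \<Rightarrow>\<^sub>0 nat) \<Rightarrow>\<^sub>0 'k) ring)"
      using keys(2) by (simp add: mpoly_ring_simps(1))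
    ultimately show ?case
      using mult[OF _ mpoly_ring_power_closed[OF mpoly_var_closed[OF keys(1)]]
        update.IH[OF keys(2)] power[OF keys(1)]] by simp
  qed
  show ?thesis
    using f
  proof (induction f rule: update_induct)
    case const
    then show ?case using assms(2)[of 0] by (simp add: mpoly_const_def)
  next
    case (update f m c)
    have keys: "Poly_Mapping.keys m \<subseteq> {..<n}" "f \<in> carrier (mpoly_ring n)"
      using update by (auto simp: keys_update mpoly_ring_simps(1))
    have "Poly_Mapping.update m c f = f + Poly_Mapping.single m c"
      using update(1) by (intro poly_mapping_eqI)
        (auto simp: lookup_update lookup_add lookup_single in_keys_iff)
    also have "Poly_Mapping.single m c = mpoly_const c * Poly_Mapping.single m 1"
      by (simp add: mpoly_const_def mult_single)
    finally have eq: "Poly_Mapping.update m c f = f + mpoly_const c * Poly_Mapping.single m 1" .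
    have "Poly_Mapping.single m 1 \<in> carrier (mpoly_ring n :: ((nat \<Rightarrow>\<^sub>0 nat) \<Rightarrow>\<^sub>0 'k) ring)"
      using keys(1) by (simp add: mpoly_ring_simps(1))
    then show ?case
      unfolding eq using keys update.IH
      by (intro add mult const monom mpoly_const_closed mpoly_ring_mult_closed)
  qed
qed

text \<open>Modulo \<open>\<mm>\<^sub>a\<close> every variable is constant, hence so is every polynomial: \<open>f - f(a)\<close> lies in
  \<open>\<mm>\<^sub>a\<close>, and \<open>f\<close> itself does when \<open>f(a) = 0\<close>.\<close>

lemma point_ideal_eq: "point_ideal n a = vanishing_ideal n {a}"
proof -
  interpret R: cring "mpoly_ring n :: ((nat \<Rightarrow>\<^sub>0 nat) \<Rightarrow>\<^sub>0 'a) ring" by (rule cring_mpoly_ring)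
  let ?G = "(\<lambda>i. mpoly_var i - mpoly_const (a i)) ` {..<n}"
  have G: "?G \<subseteq> vanishing_ideal n {a}"
    by (auto simp: vanishing_ideal_def mpoly_eval_diff mpoly_eval_var mpoly_eval_const
      mpoly_ring_diff_closed mpoly_var_closed mpoly_const_closed)
  then have Gc: "?G \<subseteq> carrier (mpoly_ring n)"
    by (auto simp: vanishing_ideal_def)
  have m: "ideal (point_ideal n a) (mpoly_ring n)"
    unfolding point_ideal_def by (rule R.genideal_ideal[OF Gc])
  have "f - mpoly_const (mpoly_eval f a) \<in> point_ideal n a" if "f \<in> carrier (mpoly_ring n)" for f
    using that
  proof (induction f rule: mpoly_ring_induct)
    case (const c)
    then show ?case using mpoly_ideal_zero[OF m] by (simp add: mpoly_eval_const)
  next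
    case (var i)
    then show ?case using R.genideal_self[OF Gc] by (auto simp: mpoly_eval_var point_ideal_def)
  next
    case (add f g)
    have "mpoly_const (mpoly_eval f a + mpoly_eval g a)
        = mpoly_const (mpoly_eval f a) + mpoly_const (mpoly_eval g a)"
      by (simp add: mpoly_const_def single_add)
    then have eq: "f + g - mpoly_const (mpoly_eval (f + g) a)
        = (f - mpoly_const (mpoly_eval f a)) + (g - mpoly_const (mpoly_eval g a))"
      by (simp add: mpoly_eval_add)
    show ?case unfolding eq by (rule mpoly_ideal_add[OF m add.IH])
  next
    case (mult f g)
    let ?u = "mpoly_const (mpoly_eval f a)" and ?v = "mpoly_const (mpoly_eval g a)"
    have "mpoly_const (mpoly_eval (f * g) a) = ?u * ?v"
      by (simp add: mpoly_const_def mult_single mpoly_eval_mult)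
    then have "f * g - mpoly_const (mpoly_eval (f * g) a) = f * (g - ?v) + ?v * (f - ?u)"
      by (simp add: algebra_simps)
    then show ?case
      using mpoly_ideal_add[OF m mpoly_ideal_mult[OF m mult.hyps(1) mult.IH(2)]
        mpoly_ideal_mult[OF m mpoly_const_closed mult.IH(1)]] by simp
  qed
  then have "vanishing_ideal n {a} \<subseteq> point_ideal n a"
    by (force simp: vanishing_ideal_def mpoly_const_def)
  moreover have "point_ideal n a \<subseteq> vanishing_ideal n {a}"
    unfolding point_ideal_def by (rule R.genideal_minimal[OF ideal_vanishing_ideal G])
  ultimately show ?thesis by blast
qed

section \<open>The fixed primes\<close>

lemma prime_power_mem:
  fixes P :: "((nat \<Rightarrow>\<^sub>0 nat) \<Rightarrow>\<^sub>0 'k::field) set"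
  assumes P: "primeideal P (mpoly_ring n)" and f: "f \<in> carrier (mpoly_ring n)" "f ^ i \<in> P"
  shows "f \<in> P"
  using f(2)
proof (induction i)
  case 0
  then show ?case
    using ideal.one_imp_carrier[OF primeideal.axioms(1)[OF P]] f(1) by simp
next
  case (Suc i)
  then show ?case
    using primeideal.I_prime[OF P f(1) mpoly_ring_power_closed[OF f(1), of i]] by auto
qed

lemma power_congruent:
  fixes P :: "((nat \<Rightarrow>\<^sub>0 nat) \<Rightarrow>\<^sub>0 'k::field) set"
  assumes P: "ideal P (mpoly_ring n)" and f: "f \<in> carrier (mpoly_ring n)" and p: "p \<in> P"
  shows "\<exists>q\<in>P. f ^ i = q + (f - p) ^ i"
proof (induction i)
  case 0
  show ?case using mpoly_ideal_zero[OF P] by auto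
next
  case (Suc i)
  then obtain q where q: "q \<in> P" "f ^ i = q + (f - p) ^ i" by blast
  have "f ^ Suc i = f * q + (f - p) ^ i * p + (f - p) ^ Suc i"
    by (simp add: q(2) algebra_simps)
  moreover have "(f - p) ^ i \<in> carrier (mpoly_ring n)"
    by (intro mpoly_ring_power_closed mpoly_ring_diff_closed f ideal.Icarr[OF P p])
  ultimately show ?case
    using mpoly_ideal_add[OF P] mpoly_ideal_mult[OF P] f p q(1) by blast
qed

text \<open>At a point of \<open>X\<close> outside \<open>V(P)\<close> an element of \<open>P\<close> can be scaled to any prescribed value, at
  a point of \<open>V(P)\<close> the polynomial already has the value \<open>0\<close>; so \<open>f\<close> can be moved into
  \<open>\<mm>\<^sub>a\<close> by subtracting an element of \<open>P\<close>.\<close>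

lemma congruent_mem_point_ideal:
  fixes P :: "((nat \<Rightarrow>\<^sub>0 nat) \<Rightarrow>\<^sub>0 'k::field) set"
  assumes P: "ideal P (mpoly_ring n)" and X: "X \<subseteq> affine_space n"
    and f: "f \<in> vanishing_ideal n (X \<inter> V_aff n P)" and a: "a \<in> X"
  shows "\<exists>p\<in>P. f - p \<in> point_ideal n a"
proof -
  have fc: "f \<in> carrier (mpoly_ring n)" using f by (simp add: vanishing_ideal_def)
  have "\<exists>p\<in>P. mpoly_eval p a = mpoly_eval f a"
  proof (cases "a \<in> V_aff n P")
    case True
    then have "mpoly_eval f a = 0" using f a by (simp add: vanishing_ideal_def)
    then show ?thesis using mpoly_ideal_zero[OF P] mpoly_eval_zero by metis
  next
    case False
    then obtain q where q: "q \<in> P" "mpoly_eval q a \<noteq> 0" using X a by (auto simp: V_aff_def)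
    let ?p = "mpoly_const (mpoly_eval f a / mpoly_eval q a) * q"
    have "mpoly_eval ?p a = mpoly_eval f a"
      using q(2) by (simp add: mpoly_eval_mult mpoly_eval_const)
    then show ?thesis using mpoly_ideal_mult[OF P mpoly_const_closed q(1)] by blast
  qed
  then obtain p where p: "p \<in> P" "mpoly_eval p a = mpoly_eval f a" by blast
  then have "f - p \<in> point_ideal n a"
    by (simp add: point_ideal_eq vanishing_ideal_def mpoly_eval_diff mpoly_ring_diff_closed[OF fc]
      ideal.Icarr[OF P])
  then show ?thesis using p(1) by blast
qed

lemma subset_vanishing_ideal_V_aff:
  "ideal P (mpoly_ring n) \<Longrightarrow> P \<subseteq> vanishing_ideal n (X \<inter> V_aff n P)"
  using ideal.Icarr by (fastforce simp: vanishing_ideal_def V_aff_def)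

lemma subset_Phi_star:
  fixes P :: "((nat \<Rightarrow>\<^sub>0 nat) \<Rightarrow>\<^sub>0 'k::field) set"
  assumes "ideal P (mpoly_ring n)"
  shows "P \<subseteq> Phi_star n X \<nu> P"
proof
  fix f assume f: "f \<in> P"
  interpret R: cring "mpoly_ring n :: ((nat \<Rightarrow>\<^sub>0 nat) \<Rightarrow>\<^sub>0 'k) ring" by (rule cring_mpoly_ring)
  have "0 \<in> point_ideal n a [^]\<^bsub>ideals_set (mpoly_ring n)\<^esub> \<nu> a" for a
    unfolding point_ideal_eq
    by (rule mpoly_ideal_zero[OF R.ideal_power_is_ideal[OF ideal_vanishing_ideal]])
  then show "f \<in> Phi_star n X \<nu> P"
    using f ideal.Icarr[OF assms f] by (force simp: Phi_star_def set_add_def')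
qed

lemma Phi_star_subset_vanishing:
  fixes P :: "((nat \<Rightarrow>\<^sub>0 nat) \<Rightarrow>\<^sub>0 'k::field) set"
  assumes pos: "\<forall>a\<in>X. 0 < \<nu> a"
  shows "Phi_star n X \<nu> P \<subseteq> vanishing_ideal n (X \<inter> V_aff n P)"
proof
  fix f assume f: "f \<in> Phi_star n X \<nu> P"
  interpret R: cring "mpoly_ring n :: ((nat \<Rightarrow>\<^sub>0 nat) \<Rightarrow>\<^sub>0 'k) ring" by (rule cring_mpoly_ring)
  have "mpoly_eval f a = 0" if a: "a \<in> X" "a \<in> V_aff n P" for a
  proof -
    obtain p g where pg: "f = p + g" "p \<in> P"
      "g \<in> point_ideal n a [^]\<^bsub>ideals_set (mpoly_ring n)\<^esub> \<nu> a"
      using f a(1) by (auto simp: Phi_star_def set_add_def')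
    have "g \<in> vanishing_ideal n {a}"
      using pg(3) R.ideal_power_subset[OF ideal_vanishing_ideal, of "\<nu> a" "{a}"] pos a(1)
      by (auto simp: point_ideal_eq)
    then show ?thesis
      using pg(1,2) a(2) by (simp add: mpoly_eval_add vanishing_ideal_def V_aff_def)
  qed
  then show "f \<in> vanishing_ideal n (X \<inter> V_aff n P)"
    using f by (auto simp: vanishing_ideal_def Phi_star_def)
qed

text \<open>This is where the boundedness of \<open>\<nu>\<close> enters: the polynomial \<open>p \<in> P\<close> that matches \<open>f\<close> at
  \<open>a\<close> varies with \<open>a\<close>, but one exponent \<open>N\<close> serves for all points.\<close>

lemma power_mem_Phi_star:
  fixes P :: "((nat \<Rightarrow>\<^sub>0 nat) \<Rightarrow>\<^sub>0 'k::field) set"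
  assumes P: "ideal P (mpoly_ring n)" and X: "X \<subseteq> affine_space n"
    and bound: "\<forall>a\<in>X. \<nu> a \<le> N" and f: "f \<in> vanishing_ideal n (X \<inter> V_aff n P)"
  shows "f ^ N \<in> Phi_star n X \<nu> P"
proof -
  interpret R: cring "mpoly_ring n :: ((nat \<Rightarrow>\<^sub>0 nat) \<Rightarrow>\<^sub>0 'k) ring" by (rule cring_mpoly_ring)
  have fc: "f \<in> carrier (mpoly_ring n)" using f by (simp add: vanishing_ideal_def)
  have "f ^ N \<in> P <+>\<^bsub>mpoly_ring n\<^esub> (point_ideal n a [^]\<^bsub>ideals_set (mpoly_ring n)\<^esub> \<nu> a)"
    if a: "a \<in> X" for a
  proof -
    obtain p where p: "p \<in> P" "f - p \<in> point_ideal n a"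
      using congruent_mem_point_ideal[OF P X f a] by blast
    obtain q where q: "q \<in> P" "f ^ N = q + (f - p) ^ N"
      using power_congruent[OF P fc p(1)] by blast
    have "(f - p) ^ N \<in> point_ideal n a [^]\<^bsub>ideals_set (mpoly_ring n)\<^esub> \<nu> a"
      using R.pow_mem_ideal_power[OF ideal_vanishing_ideal, of "f - p" "{a}" "\<nu> a" N] p(2) bound a
      by (simp add: point_ideal_eq mpoly_ring_pow)
    then show ?thesis using q by (auto simp: set_add_def')
  qed
  then show ?thesis
    using mpoly_ring_power_closed[OF fc] by (simp add: Phi_star_def)
qed

lemma Spec_Phi_eq:
  fixes X :: "(nat \<Rightarrow> 'k::field) set"
  assumes X: "X \<subseteq> affine_space n" and pos: "\<forall>a\<in>X. 0 < \<nu> a" and bound: "\<forall>a\<in>X. \<nu> a \<le> N"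
  shows "Spec_Phi n X \<nu> =
    {P. primeideal P (mpoly_ring n) \<and> vanishing_ideal n (X \<inter> V_aff n P) = P}"
proof -
  have "Phi_star n X \<nu> P = P \<longleftrightarrow> vanishing_ideal n (X \<inter> V_aff n P) = P"
    if prime: "primeideal P (mpoly_ring n)" for P
  proof
    have P: "ideal P (mpoly_ring n)" by (rule primeideal.axioms(1)[OF prime])
    show "vanishing_ideal n (X \<inter> V_aff n P) = P" if fixed: "Phi_star n X \<nu> P = P"
    proof
      show "vanishing_ideal n (X \<inter> V_aff n P) \<subseteq> P"
      proof
        fix f assume f: "f \<in> vanishing_ideal n (X \<inter> V_aff n P)"
        then show "f \<in> P"
          using prime_power_mem[OF prime, of f N] power_mem_Phi_star[OF P X bound f] fixed
          by (simp add: vanishing_ideal_def)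
      qed
    qed (rule subset_vanishing_ideal_V_aff[OF P])
    show "Phi_star n X \<nu> P = P" if "vanishing_ideal n (X \<inter> V_aff n P) = P"
      using Phi_star_subset_vanishing[OF pos, of n P] subset_Phi_star[OF P, of X \<nu>] that by auto
  qed
  then show ?thesis by (auto simp: Spec_Phi_def)
qed

section \<open>Irreducible closed sets and prime vanishing ideals\<close>

lemma closedin_V_aff:
  assumes "S \<subseteq> carrier (mpoly_ring n)"
  shows "closedin (zariski_topology n) (V_aff n S)"
proof -
  interpret R: cring "mpoly_ring n :: ((nat \<Rightarrow>\<^sub>0 nat) \<Rightarrow>\<^sub>0 'a) ring" by (rule cring_mpoly_ring)
  have "Idl\<^bsub>mpoly_ring n\<^esub> S \<subseteq> vanishing_ideal n (V_aff n S)"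
    by (rule R.genideal_minimal[OF ideal_vanishing_ideal])
      (use assms in \<open>auto simp: vanishing_ideal_def V_aff_def\<close>)
  then have "V_aff n S = V_aff n (Idl\<^bsub>mpoly_ring n\<^esub> S)"
    using R.genideal_self[OF assms] by (fastforce simp: vanishing_ideal_def V_aff_def)
  then show ?thesis
    using R.genideal_ideal[OF assms] by (auto simp: closedin_zariski_topology)
qed

lemma subset_V_aff_iff:
  assumes "C \<subseteq> affine_space n" "I \<subseteq> carrier (mpoly_ring n)"
  shows "C \<subseteq> V_aff n I \<longleftrightarrow> I \<subseteq> vanishing_ideal n C"
  using assms unfolding V_aff_def vanishing_ideal_def by blast

lemma closedin_subtopology_zariski_iff:
  assumes "X \<subseteq> affine_space n"
  shows "closedin (subtopology (zariski_topology n) X) C \<longleftrightarrow>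
    C \<subseteq> X \<and> X \<inter> V_aff n (vanishing_ideal n C) = C"
proof
  assume "closedin (subtopology (zariski_topology n) X) C"
  then obtain I where I: "ideal I (mpoly_ring n)" "C = X \<inter> V_aff n I"
    by (auto simp: closedin_subtopology closedin_zariski_topology)
  have "I \<subseteq> vanishing_ideal n C"
    unfolding I(2) by (rule subset_vanishing_ideal_V_aff[OF I(1)])
  then have "X \<inter> V_aff n (vanishing_ideal n C) \<subseteq> C"
    unfolding I(2) by (auto simp: V_aff_def)
  moreover have "C \<subseteq> V_aff n (vanishing_ideal n C)"
    using I(2) assms by (auto simp: V_aff_def vanishing_ideal_def)
  ultimately show "C \<subseteq> X \<and> X \<inter> V_aff n (vanishing_ideal n C) = C" using I(2) by blast
next
  assume "C \<subseteq> X \<and> X \<inter> V_aff n (vanishing_ideal n C) = C"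
  moreover have "closedin (zariski_topology n) (V_aff n (vanishing_ideal n C))"
    by (rule closedin_V_aff) (auto simp: vanishing_ideal_def)
  ultimately show "closedin (subtopology (zariski_topology n) X) C"
    by (metis closedin_subtopology inf_commute)
qed

text \<open>A product \<open>fg\<close> in \<open>I(C)\<close> cuts \<open>C\<close> into the zero sets of \<open>f\<close> and of \<open>g\<close>, and a
  decomposition of \<open>C\<close> into two proper closed subsets yields such a product with neither
  factor in \<open>I(C)\<close>. The whole ring as \<open>I(C)\<close> corresponds to \<open>C = {}\<close>.\<close>

lemma irreducible_in_zariski_iff:
  fixes C X :: "(nat \<Rightarrow> 'k::field) set"
  assumes X: "X \<subseteq> affine_space n" and C: "C \<subseteq> X"
  shows "irreducible_in (subtopology (zariski_topology n) X) C \<longleftrightarrow>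
    primeideal (vanishing_ideal n C) (mpoly_ring n)"
proof -
  interpret R: cring "mpoly_ring n :: ((nat \<Rightarrow>\<^sub>0 nat) \<Rightarrow>\<^sub>0 'k) ring" by (rule cring_mpoly_ring)
  have CA: "C \<subseteq> affine_space n" using X C by blast
  have top: "topspace (subtopology (zariski_topology n) X) = X"
    using X by (auto simp: topspace_zariski_topology)
  have sub: "subtopology (subtopology (zariski_topology n) X) C = subtopology (zariski_topology n) C"
    using C by (simp add: subtopology_subtopology inf.absorb2)
  have one: "(1 :: (nat \<Rightarrow>\<^sub>0 nat) \<Rightarrow>\<^sub>0 'k) \<in> carrier (mpoly_ring n)"
    using R.one_closed by simp
  show ?thesis
  proof
    assume irr: "irreducible_in (subtopology (zariski_topology n) X) C"
    show "primeideal (vanishing_ideal n C) (mpoly_ring n)"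
    proof (rule primeidealI[OF ideal_vanishing_ideal R.cring_axioms])
      obtain a where "a \<in> C" using irr by (auto simp: irreducible_in_def)
      then have "1 \<notin> vanishing_ideal n C" by (auto simp: vanishing_ideal_def mpoly_eval_one)
      then show "carrier (mpoly_ring n) \<noteq> vanishing_ideal n C" using one by blast
    next
      fix f g :: "(nat \<Rightarrow>\<^sub>0 nat) \<Rightarrow>\<^sub>0 'k"
      assume fc: "f \<in> carrier (mpoly_ring n)" and gc: "g \<in> carrier (mpoly_ring n)"
        and "f \<otimes>\<^bsub>mpoly_ring n\<^esub> g \<in> vanishing_ideal n C"
      then have "\<forall>a\<in>C. mpoly_eval f a = 0 \<or> mpoly_eval g a = 0"
        by (simp add: vanishing_ideal_def mpoly_eval_mult)
      then have "C = (C \<inter> V_aff n {f}) \<union> (C \<inter> V_aff n {g})"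
        using CA by (auto simp: V_aff_def)
      moreover have "closedin (subtopology (zariski_topology n) C) (C \<inter> V_aff n {h})"
        if "h \<in> carrier (mpoly_ring n)" for h :: "(nat \<Rightarrow>\<^sub>0 nat) \<Rightarrow>\<^sub>0 'k"
        using closedin_V_aff[of "{h}" n] that by (auto simp: closedin_subtopology)
      ultimately have "C \<inter> V_aff n {f} = C \<or> C \<inter> V_aff n {g} = C"
        using irr fc gc unfolding irreducible_in_def sub by metis
      then show "f \<in> vanishing_ideal n C \<or> g \<in> vanishing_ideal n C"
        using fc gc by (auto simp: vanishing_ideal_def V_aff_def)
    qed
  next
    assume prime: "primeideal (vanishing_ideal n C) (mpoly_ring n)"
    have "C \<noteq> {}"
      using primeideal.I_notcarr[OF prime] by (auto simp: vanishing_ideal_def)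
    moreover have "A = C \<or> B = C"
      if A: "closedin (subtopology (zariski_topology n) C) A"
        and B: "closedin (subtopology (zariski_topology n) C) B" and AB: "C = A \<union> B" for A B
    proof (rule ccontr)
      assume neg: "\<not> (A = C \<or> B = C)"
      \<comment> \<open>A closed set is determined by its vanishing ideal, so a proper closed subset \<open>D\<close>
          satisfies an equation that \<open>C\<close> does not.\<close>
      have sep: "\<exists>f. f \<in> vanishing_ideal n D \<and> f \<notin> vanishing_ideal n C"
        if D: "closedin (subtopology (zariski_topology n) C) D" "D \<noteq> C" for D
      proof (rule ccontr)
        assume "\<not> ?thesis"
        then have "vanishing_ideal n D \<subseteq> vanishing_ideal n C" by blast
        then have "C \<subseteq> V_aff n (vanishing_ideal n D)"
          using CA by (auto simp: V_aff_def vanishing_ideal_def)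
        then show False using D closedin_subtopology_zariski_iff[OF CA, of D] by blast
      qed
      obtain f where f: "f \<in> vanishing_ideal n A" "f \<notin> vanishing_ideal n C"
        using sep[OF A] neg by blast
      obtain g where g: "g \<in> vanishing_ideal n B" "g \<notin> vanishing_ideal n C"
        using sep[OF B] neg by blast
      have "f * g \<in> vanishing_ideal n C"
        using f(1) g(1) AB by (auto simp: vanishing_ideal_def mpoly_eval_mult mpoly_ring_mult_closed)
      then show False
        using primeideal.I_prime[OF prime, of f g] f g
          ideal.Icarr[OF ideal_vanishing_ideal f(1)] ideal.Icarr[OF ideal_vanishing_ideal g(1)]
        by auto
    qed
    ultimately show "irreducible_in (subtopology (zariski_topology n) X) C"
      unfolding irreducible_in_def sub top using C by blast
  qed
qed

lemma Sob_zariski_eq: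
  assumes "X \<subseteq> affine_space n"
  shows "Sob (subtopology (zariski_topology n) X) =
    {C. C \<subseteq> X \<and> X \<inter> V_aff n (vanishing_ideal n C) = C \<and>
      primeideal (vanishing_ideal n C) (mpoly_ring n)}"
  using closedin_subtopology_zariski_iff[OF assms] irreducible_in_zariski_iff[OF assms]
  by (auto simp: Sob_def)

lemma openin_subtopology_zariski_iff:
  assumes "X \<subseteq> affine_space n"
  shows "openin (subtopology (zariski_topology n) X) U \<longleftrightarrow>
    (\<exists>J. ideal J (mpoly_ring n) \<and> U = X - V_aff n J)"
proof -
  have "openin (subtopology (zariski_topology n) X) U \<longleftrightarrow>
      U \<subseteq> X \<and> (\<exists>J. ideal J (mpoly_ring n) \<and> X - U = X \<inter> V_aff n J)"
    using assms by (auto simp: openin_closedin_eq topspace_zariski_topology inf.absorb2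
      closedin_subtopology closedin_zariski_topology)
  then show ?thesis by blast
qed

section \<open>The homeomorphism\<close>

theorem theorem5p8:
  fixes n :: nat
    and X :: "(nat \<Rightarrow> 'k::alg_closed_field) set"
    and \<nu> :: "(nat \<Rightarrow> 'k) \<Rightarrow> nat"
  assumes "X \<subseteq> affine_space n"
    and "\<forall>a\<in>X. 0 < \<nu> a"
    and "\<exists>N>0. \<forall>a\<in>X. \<nu> a \<le> N"
  shows "homeomorphic_map
           (Spec_Phi_topology n X \<nu>)
           (Sob_topology (subtopology (zariski_topology n) X))
           (\<lambda>P. X \<inter> V_aff n P)"
proof -
  let ?T = "subtopology (zariski_topology n) X"
  let ?S = "Spec_Phi n X \<nu>" and ?\<Theta> = "\<lambda>P. X \<inter> V_aff n P"
  let ?W = "\<lambda>U. {C \<in> Sob ?T. C \<inter> U \<noteq> {}}"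
  note X = assms(1)
  obtain N where "\<forall>a\<in>X. \<nu> a \<le> N" using assms(3) by blast
  then have S: "?S = {P. primeideal P (mpoly_ring n) \<and> vanishing_ideal n (?\<Theta> P) = P}"
    by (rule Spec_Phi_eq[OF X assms(2)])
  have bij: "bij_betw ?\<Theta> ?S (Sob ?T)"
  proof (rule bij_betw_byWitness[where f' = "vanishing_ideal n"])
    show "\<forall>P\<in>?S. vanishing_ideal n (?\<Theta> P) = P" by (simp add: S)
    show "\<forall>C\<in>Sob ?T. ?\<Theta> (vanishing_ideal n C) = C" by (simp add: Sob_zariski_eq[OF X])
    show "?\<Theta> ` ?S \<subseteq> Sob ?T" by (auto simp: S Sob_zariski_eq[OF X])
    show "vanishing_ideal n ` Sob ?T \<subseteq> ?S" by (auto simp: S Sob_zariski_eq[OF X])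
  qed
  have inS: "?\<Theta> P \<in> Sob ?T" if "P \<in> ?S" for P
    using bij that by (auto simp: bij_betw_def)
  have meets: "?\<Theta> P \<in> ?W (X - V_aff n J) \<longleftrightarrow> \<not> J \<subseteq> P"
    if P: "P \<in> ?S" and J: "ideal J (mpoly_ring n)" for P J
  proof -
    have "J \<subseteq> carrier (mpoly_ring n)" using ideal.Icarr[OF J] by blast
    then have "?\<Theta> P \<subseteq> V_aff n J \<longleftrightarrow> J \<subseteq> vanishing_ideal n (?\<Theta> P)"
      using X by (intro subset_V_aff_iff) auto
    also have "\<dots> \<longleftrightarrow> J \<subseteq> P" using P by (simp add: S)
    finally show ?thesis using inS[OF P] by blast
  qed
  have top: "topspace (Sob_topology ?T) = Sob ?T"
  proof -
    have "C \<inter> topspace ?T \<noteq> {}" if "C \<in> Sob ?T" for C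
      using that by (auto simp: Sob_def irreducible_in_def)
    then show ?thesis unfolding Sob_topology_def topology_generated_by_topspace by blast
  qed
  show ?thesis
  proof (rule bijective_open_imp_homeomorphic_map)
    show "?\<Theta> ` topspace (Spec_Phi_topology n X \<nu>) = topspace (Sob_topology ?T)"
      using bij by (simp add: bij_betw_def top topspace_Spec_Phi_topology)
    show "inj_on ?\<Theta> (topspace (Spec_Phi_topology n X \<nu>))"
      using bij by (simp add: bij_betw_def topspace_Spec_Phi_topology)
    show "continuous_map (Spec_Phi_topology n X \<nu>) (Sob_topology ?T) ?\<Theta>"
      unfolding Sob_topology_def
    proof (rule continuous_on_generated_topo)
      show "?\<Theta> ` topspace (Spec_Phi_topology n X \<nu>) \<subseteq> \<Union> {?W U |U. openin ?T U}"
        using bij top unfolding Sob_topology_def topology_generated_by_topspace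
        by (simp add: bij_betw_def topspace_Spec_Phi_topology)
      fix W assume "W \<in> {?W U |U. openin ?T U}"
      then obtain J where J: "ideal J (mpoly_ring n)" and W: "W = ?W (X - V_aff n J)"
        by (auto simp: openin_subtopology_zariski_iff[OF X])
      have "?\<Theta> -` W \<inter> ?S = ?S - {P \<in> ?S. J \<subseteq> P}"
        unfolding W using meets[OF _ J] by blast
      moreover have "closedin (Spec_Phi_topology n X \<nu>) {P \<in> ?S. J \<subseteq> P}"
        using J closedin_Spec_Phi_topology by blast
      ultimately show "openin (Spec_Phi_topology n X \<nu>)
          (?\<Theta> -` W \<inter> topspace (Spec_Phi_topology n X \<nu>))"
        by (simp add: openin_closedin_eq topspace_Spec_Phi_topology Diff_Diff_Int Int_def)
    qed
    show "open_map (Spec_Phi_topology n X \<nu>) (Sob_topology ?T) ?\<Theta>"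
      unfolding open_map_def
    proof (intro allI impI)
      fix U assume "openin (Spec_Phi_topology n X \<nu>) U"
      then obtain J where J: "ideal J (mpoly_ring n)" and "U \<subseteq> ?S" "?S - U = {P \<in> ?S. J \<subseteq> P}"
        by (auto simp: openin_closedin_eq topspace_Spec_Phi_topology closedin_Spec_Phi_topology)
      then have U: "U = {P \<in> ?S. \<not> J \<subseteq> P}" by blast
      have "?\<Theta> ` U = ?\<Theta> ` ?S \<inter> ?W (X - V_aff n J)"
        unfolding U using meets[OF _ J] by blast
      also have "\<dots> = ?W (X - V_aff n J)" using bij by (auto simp: bij_betw_def)
      finally have "?\<Theta> ` U = ?W (X - V_aff n J)" .
      then show "openin (Sob_topology ?T) (?\<Theta> ` U)"
        unfolding Sob_topology_def using J openin_subtopology_zariski_iff[OF X]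
        by (auto intro!: topology_generated_by_Basis)
    qed
  qed
qed

end
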